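(* Let $\mathcal{H}$ be a real Hilbert space, let $\mu>0$ and $\beta>0$, let $A\colon\mathcal{H}\to 2^{\mathcal{H}}$ be maximally monotone, let $B\colon\mathcal{H}\to\mathcal{H}$ be monotone and $\mu$-Lipschitzian, and let $C\colon\mathcal{H}\to\mathcal{H}$ be $\beta$-cocoercive. Assume that $\operatorname{zer}(A+B+C)\neq\varnothing$. Let $\zeta\in\,]0,1/2[$ and $\xi\in\,]0,+\infty[$, and let $\gamma>0$ be such that $$\gamma<\frac{1-\zeta}{\mu},\qquad \gamma<\frac{4\beta\zeta}{1+\xi},\qquad \gamma<\frac{\sqrt{2}-1}{\mu},\qquad \gamma<\frac{1-2\zeta}{\mu(\sqrt{2}+1)+\frac{2}{\beta\xi}}.$$ Let $(x_0,x_{-1})\in\mathcal{H}^2$ and let $(x_n)_{n\in\mathbb{N}}$ be generated by $$(\forall n\in\mathbb{N})\qquad y_n=2x_n-x_{n-1},\qquad x_{n+1}=J_{\gamma A}(x_n-\gamma By_n-\gamma Cx_n).$$ Then there exists $\overline{x}\in\operatorname{zer}(A+B+C)$ such that $x_n$ converges weakly to $\overline{x}$.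
   Context: $\mathbb{N}=\{0,1,2,\dots\}$. The inner product and norm of $\mathcal{H}$ are $\langle\cdot\mid\cdot\rangle$ and $\|\cdot\|$. A set-valued operator $A\colon\mathcal{H}\to 2^{\mathcal{H}}$ has graph $\operatorname{gra}(A)=\{(x,u)\in\mathcal{H}\times\mathcal{H}: u\in Ax\}$. It is monotone if $\langle x-y\mid u-v\rangle\geq 0$ for all $(x,u),(y,v)\in\operatorname{gra}(A)$, and maximally monotone if it is monotone and there is no monotone operator whose graph properly contains $\operatorname{gra}(A)$. The zero set is $\operatorname{zer}(A)=\{x\in\mathcal{H}: 0\in Ax\}$. The resolvent of $A$ is $J_A=(\operatorname{Id}+A)^{-1}$, which is single-valued and defined on all of $\mathcal{H}$ when $A$ is maximally monotone; thus $J_{\gamma A}=(\operatorname{Id}+\gamma A)^{-1}$. A single-valued operator $B\colon\mathcal{H}\to\mathcal{H}$ is $\mu$-Lipschitzian if $\|Bx-By\|\leq\mu\|x-y\|$ for all $x,y\in\mathcal{H}$. A single-valued operator $C\colon\mathcal{H}\to\mathcal{H}$ is $\beta$-cocoercive if $\langle x-y\mid Cx-Cy\rangle\geq\beta\|Cx-Cy\|^2$ for all $x,y\in\mathcal{H}$. *)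

theory Defs
  imports "HOL-Analysis.Analysis" "HOL-Library.Set_Algebras"
begin

text \<open>A real Hilbert space is a type of sort \<open>{real_inner, complete_space}\<close>. A set-valued
  operator is a function into the power set, and a single-valued operator \<open>B\<close> is identified
  with \<open>\<lambda>x. {B x}\<close>.\<close>

type_synonym 'a set_operator = "'a \<Rightarrow> 'a set"

definition single_op :: "('a \<Rightarrow> 'a) \<Rightarrow> 'a set_operator" where
  "single_op B = (\<lambda>x. {B x})"

definition gra :: "'a set_operator \<Rightarrow> ('a \<times> 'a) set" where
  "gra A = {(x, u). u \<in> A x}"

definition zer :: "'a::zero set_operator \<Rightarrow> 'a set" where
  "zer A = {x. 0 \<in> A x}"

text \<open>The right-hand side below is the Minkowski sum of sets.\<close>

definition sum_op :: "'a::plus set_operator \<Rightarrow> 'a set_operator \<Rightarrow> 'a set_operator" where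
  "sum_op A B = (\<lambda>x. A x + B x)"

definition scale_op :: "real \<Rightarrow> 'a::real_vector set_operator \<Rightarrow> 'a set_operator" where
  "scale_op c A = (\<lambda>x. (\<lambda>u. c *\<^sub>R u) ` A x)"

definition inverse_op :: "'a set_operator \<Rightarrow> 'a set_operator" where
  "inverse_op A = (\<lambda>u. {x. u \<in> A x})"

definition monotone_op :: "'a::real_inner set_operator \<Rightarrow> bool" where
  "monotone_op A \<longleftrightarrow> (\<forall>(x, u) \<in> gra A. \<forall>(y, v) \<in> gra A. (x - y) \<bullet> (u - v) \<ge> 0)"

definition maximally_monotone :: "'a::real_inner set_operator \<Rightarrow> bool" where
  "maximally_monotone A \<longleftrightarrow>
     monotone_op A \<and> \<not> (\<exists>A'. monotone_op A' \<and> gra A \<subset> gra A')"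

definition cocoercive :: "real \<Rightarrow> ('a::real_inner \<Rightarrow> 'a) \<Rightarrow> bool" where
  "cocoercive \<beta> C \<longleftrightarrow> (\<forall>x y. (x - y) \<bullet> (C x - C y) \<ge> \<beta> * (norm (C x - C y))\<^sup>2)"

definition resolvent_op :: "'a::plus set_operator \<Rightarrow> 'a set_operator" where
  "resolvent_op A = inverse_op (sum_op (single_op id) A)"

text \<open>The resolvent as a function. For maximally monotone \<open>A\<close> on a Hilbert space,
  \<open>resolvent_op A z\<close> is a singleton for every \<open>z\<close> (Minty), and \<open>resolvent A z\<close> is its
  element; without such a hypothesis the value of \<^const>\<open>the_elem\<close> is unspecified.\<close>

definition resolvent :: "'a::plus set_operator \<Rightarrow> 'a \<Rightarrow> 'a" where
  "resolvent A z = the_elem (resolvent_op A z)"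

definition converges_weakly :: "(nat \<Rightarrow> 'a::real_inner) \<Rightarrow> 'a \<Rightarrow> bool" where
  "converges_weakly x l \<longleftrightarrow> (\<forall>u. (\<lambda>n. x n \<bullet> u) \<longlonglongrightarrow> l \<bullet> u)"

end

theory Submission
  imports Defs
begin

text \<open>Let \<open>z\<close> be a zero. Monotonicity of \<open>A\<close> is used twice, between \<open>x\<^bsub>n+1\<^esub>\<close> and \<open>z\<close> and
  between \<open>x\<^bsub>n+1\<^esub>\<close> and \<open>x\<^sub>n\<close>. Adding the two inequalities makes the \<open>B\<close>-terms telescope up to
  \<open>\<langle>x\<^bsub>n+1\<^esub> - y\<^sub>n, B y\<^sub>n - B y\<^bsub>n-1\<^esub>\<rangle>\<close>, and cocoercivity absorbs the \<open>C\<close>-terms, so an energy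
  comparable to \<open>\<parallel>x\<^sub>n - z\<parallel>\<^sup>2\<close> decreases by a multiple of
  \<open>\<parallel>x\<^bsub>n+1\<^esub> - x\<^sub>n\<parallel>\<^sup>2 + \<parallel>x\<^bsub>n+1\<^esub> - y\<^sub>n\<parallel>\<^sup>2\<close> as soon as
  \<open>\<gamma>/(2\<beta>) + \<gamma>\<mu>(1 + \<surd>2) < 1\<close>. Hence these differences vanish, \<open>\<parallel>x\<^sub>n - z\<parallel>\<close> converges, every
  weak cluster point is a zero because the graph of \<open>A + B + C\<close> is weak-strong closed, and Opial's
  argument gives weak convergence. Weak cluster points are taken along filters, so that Tychonoff's
  theorem applies without separability or subsequences.\<close>

section \<open>Quadratic minimization and weak convergence\<close>

text \<open>Letting \<open>t\<close> tend to 0 from the right extracts a first-order condition from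
  an inequality along a segment.\<close>

lemma nonneg_if_perturbed_nonneg:
  fixes a b :: real
  assumes "\<And>t. 0 < t \<Longrightarrow> t < 1 \<Longrightarrow> 0 \<le> a + t * b"
  shows "0 \<le> a"
proof -
  have "((\<lambda>t. a + t * b) \<longlongrightarrow> a + 0 * b) (at_right 0)"
    by (intro tendsto_intros)
  moreover have "\<forall>\<^sub>F t in at_right 0. 0 \<le> a + t * b"
    using assms eventually_at_right_less[of "0::real"]
    by (auto simp: eventually_at_right_field intro!: exI[of _ 1])
  ultimately show ?thesis
    by (auto dest!: tendsto_lowerbound)
qed

text \<open>Applied to graphs of linear functionals this yields the Riesz representation theorem, and
  applied to convex hulls of monotone graphs it yields Minty's theorem. The pair \<open>(x, s)\<close> is the
  limit of a minimizing sequence of \<open>(norm c)\<^sup>2 + t\<close>; it lies in the closure of \<open>K\<close> but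
  possibly not in \<open>K\<close>.\<close>

lemma convex_quadratic_minimum:
  fixes K :: "('a::{real_inner, complete_space} \<times> real) set"
  assumes K: "convex K" "K \<noteq> {}"
    and lower: "\<And>c t. (c, t) \<in> K \<Longrightarrow> m \<le> (norm c)\<^sup>2 + t"
  obtains x s where "m \<le> (norm x)\<^sup>2 + s"
    and "\<forall>(c, t) \<in> K. 0 \<le> 2 * (x \<bullet> (c - x)) + t - s"
proof -
  define \<psi> where "\<psi> = (\<lambda>p::'a \<times> real. (norm (fst p))\<^sup>2 + snd p)"
  define I where "I = Inf (\<psi> ` K)"
  have bdd: "bdd_below (\<psi> ` K)"
    using lower by (intro bdd_belowI[of _ m]) (auto simp: \<psi>_def)
  have I_le: "I \<le> \<psi> p" if "p \<in> K" for p
    unfolding I_def using that bdd by (auto intro: cInf_lower)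
  have m_I: "m \<le> I"
    unfolding I_def using K(2) lower by (intro cInf_greatest) (auto simp: \<psi>_def)
  have "\<exists>p\<in>K. \<psi> p < I + inverse (Suc n)" for n
    using cInf_lessD[of "\<psi> ` K" "I + inverse (Suc n)"] K(2) unfolding I_def by auto
  then obtain p where pK: "p n \<in> K" and p_less: "\<psi> (p n) < I + inverse (Suc n)" for n
    by metis
  \<comment> \<open>Parallelogram law: the midpoint of \<open>p j\<close> and \<open>p k\<close>
    lies in \<open>K\<close>, so its value is at least \<open>I\<close>, while both end values are
    close to \<open>I\<close>.\<close>
  have near: "(norm (fst (p j) - fst (p k)))\<^sup>2 \<le> 2 * inverse (Suc j) + 2 * inverse (Suc k)" for j k
  proof -
    let ?m = "(1/2) *\<^sub>R p j + (1/2) *\<^sub>R p k"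
    have "?m \<in> K"
      using K(1) pK by (intro convexD) auto
    then have "I \<le> \<psi> ?m"
      by (rule I_le)
    also have "\<psi> ?m = (\<psi> (p j) + \<psi> (p k)) / 2 - (norm (fst (p j) - fst (p k)))\<^sup>2 / 4"
      unfolding \<psi>_def power2_norm_eq_inner
      by (simp add: inner_simps inner_commute field_simps)
    finally have mid: "I \<le> (\<psi> (p j) + \<psi> (p k)) / 2 - (norm (fst (p j) - fst (p k)))\<^sup>2 / 4" .
    have "I \<le> (v + w) / 2 - D / 4 \<Longrightarrow> v < I + a \<Longrightarrow> w < I + b \<Longrightarrow> D \<le> 2 * a + 2 * b"
      for v w D a b :: real
      by (simp add: field_simps)
    from this[OF mid p_less p_less] show ?thesis .
  qed
  have "Cauchy (\<lambda>n. fst (p n))"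
  proof (rule CauchyI)
    fix e :: real
    assume "e > 0"
    then obtain N where N: "inverse (real (Suc N)) < e\<^sup>2 / 4"
      using reals_Archimedean[of "e\<^sup>2 / 4"] by auto
    have "norm (fst (p j) - fst (p k)) < e" if "j \<ge> N" "k \<ge> N" for j k
    proof -
      have "inverse (real (Suc j)) \<le> inverse (Suc N)" "inverse (real (Suc k)) \<le> inverse (Suc N)"
        using that by auto
      then have "(norm (fst (p j) - fst (p k)))\<^sup>2 < e\<^sup>2"
        using near[of j k] N by linarith
      then show ?thesis
        using \<open>e > 0\<close> by (simp add: power2_less_imp_less)
    qed
    then show "\<exists>M. \<forall>m\<ge>M. \<forall>n\<ge>M. norm (fst (p m) - fst (p n)) < e"
      by blast
  qed
  then obtain x where x: "(\<lambda>n. fst (p n)) \<longlonglongrightarrow> x"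
    using convergent_eq_Cauchy by blast
  have \<psi>_lim: "(\<lambda>n. \<psi> (p n)) \<longlonglongrightarrow> I"
  proof (rule tendsto_sandwich)
    show "\<forall>\<^sub>F n in sequentially. I \<le> \<psi> (p n)"
      using I_le pK by simp
    show "\<forall>\<^sub>F n in sequentially. \<psi> (p n) \<le> I + inverse (real (Suc n))"
      using p_less by (simp add: less_imp_le)
    show "(\<lambda>n. I + inverse (real (Suc n))) \<longlonglongrightarrow> I"
      using tendsto_add[OF tendsto_const LIMSEQ_inverse_real_of_nat, of I] by simp
  qed simp
  \<comment> \<open>The second components converge because both \<open>\<psi> (p n)\<close> and the
    norms of the first components do.\<close>
  define s where "s = I - (norm x)\<^sup>2"
  have "(\<lambda>n. \<psi> (p n) - (norm (fst (p n)))\<^sup>2) \<longlonglongrightarrow> s"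
    unfolding s_def by (intro tendsto_intros \<psi>_lim x)
  then have s: "(\<lambda>n. snd (p n)) \<longlonglongrightarrow> s"
    by (simp add: \<psi>_def)
  have "0 \<le> 2 * (x \<bullet> (c - x)) + t - s" if ct: "(c, t) \<in> K" for c t
  proof (rule nonneg_if_perturbed_nonneg)
    fix r :: real
    assume r: "0 < r" "r < 1"
    \<comment> \<open>This is \<open>I \<le> \<psi>\<close> at the point of the segment from
      \<open>p n\<close> to \<open>(c, t)\<close> with parameter \<open>r\<close>, expanded in
      \<open>r\<close>.\<close>
    have "I \<le> \<psi> (p n) + r * (2 * (fst (p n) \<bullet> (c - fst (p n))) + t - snd (p n))
        + r\<^sup>2 * (norm (c - fst (p n)))\<^sup>2" for n
    proof -
      have "(1 - r) *\<^sub>R p n + r *\<^sub>R (c, t) \<in> K"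
        using K(1) pK ct r by (intro convexD) auto
      from I_le[OF this] show ?thesis
        unfolding \<psi>_def power2_norm_eq_inner
        by (simp add: inner_simps inner_commute algebra_simps power2_eq_square[of r])
    qed
    moreover have "(\<lambda>n. \<psi> (p n) + r * (2 * (fst (p n) \<bullet> (c - fst (p n))) + t - snd (p n))
        + r\<^sup>2 * (norm (c - fst (p n)))\<^sup>2)
      \<longlonglongrightarrow> I + r * (2 * (x \<bullet> (c - x)) + t - s) + r\<^sup>2 * (norm (c - x))\<^sup>2"
      by (intro tendsto_intros \<psi>_lim x s)
    ultimately have "I \<le> I + r * (2 * (x \<bullet> (c - x)) + t - s) + r\<^sup>2 * (norm (c - x))\<^sup>2"
      by (intro LIMSEQ_le_const) auto
    then have "0 \<le> r * (2 * (x \<bullet> (c - x)) + t - s + r * (norm (c - x))\<^sup>2)"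
      by (simp add: algebra_simps power2_eq_square)
    then show "0 \<le> 2 * (x \<bullet> (c - x)) + t - s + r * (norm (c - x))\<^sup>2"
      using r by (simp add: zero_le_mult_iff)
  qed
  then show thesis
    using that[of x s] m_I by (auto simp: s_def)
qed

text \<open>The representing vector minimizes \<open>(norm c)\<^sup>2 - 2 * L c\<close>: the
  first-order condition bounds an affine function of \<open>r\<close> below along each ray
  \<open>r *\<^sub>R u\<close>, so its slope is zero.\<close>

lemma riesz_representation:
  fixes L :: "'a::{real_inner, complete_space} \<Rightarrow> real"
  assumes "bounded_linear L"
  obtains l where "\<And>u. L u = l \<bullet> u"
proof -
  interpret L: bounded_linear L by fact
  obtain B where B: "\<bar>L u\<bar> \<le> norm u * B" for u
    using L.bounded by auto
  let ?K = "range (\<lambda>u. (u, - 2 * L u))"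
  have convex: "convex ?K"
    by (auto intro!: convexI image_eqI simp: L.add L.scale algebra_simps)
  have lower: "- (B\<^sup>2) \<le> (norm c)\<^sup>2 + t" if "(c, t) \<in> ?K" for c t
    using that B[of c] zero_le_power2[of "norm c - B"]
    by (auto simp: power2_diff abs_le_iff)
  obtain x s where "- (B\<^sup>2) \<le> (norm x)\<^sup>2 + s"
    and min: "\<forall>(c, t) \<in> ?K. 0 \<le> 2 * (x \<bullet> (c - x)) + t - s"
    by (rule convex_quadratic_minimum[OF convex _ lower]) auto
  from min have *: "0 \<le> 2 * (x \<bullet> (c - x)) - 2 * L c - s" for c
    by force
  have "L u = x \<bullet> u" for u
  proof (rule ccontr)
    assume "L u \<noteq> x \<bullet> u"
    define d where "d = x \<bullet> u - L u"
    \<comment> \<open>Chosen so that \<open>r = - e / (2 * d)\<close> turns the lower bound below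
      into 0 \<le> -1.\<close>
    define e where "e = 1 - 2 * (x \<bullet> x) - s"
    have "d \<noteq> 0"
      using \<open>L u \<noteq> x \<bullet> u\<close> by (simp add: d_def)
    have "0 \<le> 2 * r * d - 2 * (x \<bullet> x) - s" for r
      using *[of "r *\<^sub>R u"] by (simp add: L.scale inner_simps d_def algebra_simps)
    from this[of "- e / (2 * d)"] have "0 \<le> - e - 2 * (x \<bullet> x) - s"
      using \<open>d \<noteq> 0\<close> by simp
    then show False
      unfolding e_def by linarith
  qed
  then show thesis
    using that by blast
qed

text \<open>The functionals \<open>\<phi> i\<close> lie in a product of compact intervals, so their
  image filter has a cluster point \<open>L\<close> there. Pointwise limits keep linearity and the
  bound, and Riesz turns \<open>L\<close> into a vector.\<close>

lemma weak_cluster_point: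
  fixes x :: "'i \<Rightarrow> 'a::{real_inner, complete_space}"
  assumes "F \<noteq> bot" and bounded: "\<And>i. norm (x i) \<le> R"
  obtains G l where "G \<noteq> bot" "G \<le> F" "\<And>u. ((\<lambda>i. x i \<bullet> u) \<longlongrightarrow> l \<bullet> u) G"
proof -
  define \<phi> where "\<phi> = (\<lambda>i u. x i \<bullet> u)"
  define U :: "('a \<Rightarrow> real) set" where "U = (\<Pi>\<^sub>E u\<in>UNIV. {- R * norm u .. R * norm u})"
  have "compactin (product_topology (\<lambda>_. euclidean) UNIV) U"
    unfolding U_def compactin_PiE by simp
  then have "compact U"
    by (simp add: euclidean_product_topology)
  have bound: "\<bar>\<phi> i u\<bar> \<le> R * norm u" for i u
    unfolding \<phi>_def using Cauchy_Schwarz_ineq2[of "x i" u] bounded[of i]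
    by (meson mult_right_mono norm_ge_zero order_trans)
  then have U: "\<phi> i \<in> U" for i
    by (auto simp: U_def abs_le_iff minus_le_iff)
  have "filtermap \<phi> F \<noteq> bot"
    using assms(1) by (simp add: filtermap_bot_iff)
  moreover have "eventually (\<lambda>f. f \<in> U) (filtermap \<phi> F)"
    using U by (simp add: eventually_filtermap)
  ultimately obtain L where L: "inf (nhds L) (filtermap \<phi> F) \<noteq> bot"
    using \<open>compact U\<close> unfolding compact_filter by blast
  \<comment> \<open>Refining \<open>F\<close> by the preimages of neighbourhoods of \<open>L\<close>
    forces convergence to \<open>L\<close>; that \<open>L\<close> is a cluster point makes the
    refinement proper.\<close>
  define G where "G = inf (filtercomap \<phi> (nhds L)) F"
  have "G \<noteq> bot"
  proof
    assume "G = bot"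
    then obtain P Q where P: "eventually P (nhds L)" and Q: "eventually Q F"
      and PQ: "\<And>i. P (\<phi> i) \<Longrightarrow> Q i \<Longrightarrow> False"
      unfolding G_def trivial_limit_def eventually_inf eventually_filtercomap by blast
    have "eventually (\<lambda>f. \<not> P f) (filtermap \<phi> F)"
      unfolding eventually_filtermap using Q by (rule eventually_mono) (use PQ in blast)
    then have "eventually (\<lambda>_. False) (inf (nhds L) (filtermap \<phi> F))"
      using P unfolding eventually_inf by blast
    then show False
      using L by (simp add: trivial_limit_def)
  qed
  moreover have "G \<le> F"
    by (simp add: G_def)
  moreover have "(\<phi> \<longlongrightarrow> L) G"
    unfolding G_def by (intro filterlim_mono[OF filterlim_filtercomap order_refl]) simp
  note lim = continuous_on_tendsto_compose[OF continuous_on_product_coordinates this UNIV_I, simplified]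
  have "bounded_linear L"
  proof (rule bounded_linear_intro)
    show "L (u + v) = L u + L v" for u v
      using tendsto_unique[OF \<open>G \<noteq> bot\<close> lim[of "u + v"]] tendsto_add[OF lim lim, of u v]
      by (simp add: \<phi>_def inner_simps)
    show "L (r *\<^sub>R u) = r *\<^sub>R L u" for r u
      using tendsto_unique[OF \<open>G \<noteq> bot\<close> lim[of "r *\<^sub>R u"]]
        tendsto_mult[OF tendsto_const lim, of r u]
      by (simp add: \<phi>_def)
    show "norm (L u) \<le> norm u * R" for u
      using tendsto_upperbound[OF tendsto_norm[OF lim[of u]] _ \<open>G \<noteq> bot\<close>] bound
      by (simp add: mult.commute)
  qed
  then obtain l where "\<And>u. L u = l \<bullet> u"
    using riesz_representation by metis
  ultimately show thesis
    using that[of G l] lim by (simp add: \<phi>_def)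
qed

text \<open>If convergence fails against some \<open>u\<close>, the indices with error at least
  \<open>e\<close> are met frequently. A cluster point along them would have to be \<open>l\<close>,
  which the error excludes.\<close>

lemma converges_weaklyI:
  fixes x :: "nat \<Rightarrow> 'a::{real_inner, complete_space}"
  assumes "\<And>n. norm (x n) \<le> R"
    and unique: "\<And>G l'. G \<noteq> bot \<Longrightarrow> G \<le> sequentially \<Longrightarrow>
      (\<And>u. ((\<lambda>n. x n \<bullet> u) \<longlongrightarrow> l' \<bullet> u) G) \<Longrightarrow> l' = l"
  shows "converges_weakly x l"
proof (unfold converges_weakly_def, rule ccontr)
  assume "\<not> (\<forall>u. (\<lambda>n. x n \<bullet> u) \<longlonglongrightarrow> l \<bullet> u)"
  then obtain u e where e: "e > 0"
    and freq: "\<not> eventually (\<lambda>n. dist (x n \<bullet> u) (l \<bullet> u) < e) sequentially"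
    by (auto simp: tendsto_iff)
  let ?S = "{n. \<not> dist (x n \<bullet> u) (l \<bullet> u) < e}"
  have "inf sequentially (principal ?S) \<noteq> bot"
    using freq by (auto simp: trivial_limit_def eventually_inf_principal)
  then obtain G l' where G: "G \<noteq> bot" "G \<le> inf sequentially (principal ?S)"
    and l': "\<And>u. ((\<lambda>n. x n \<bullet> u) \<longlongrightarrow> l' \<bullet> u) G"
    using weak_cluster_point assms(1) by metis
  then have "l' = l"
    using unique by simp
  have "eventually (\<lambda>n. dist (x n \<bullet> u) (l \<bullet> u) < e) G"
    using l'[of u] e unfolding \<open>l' = l\<close> tendsto_iff by blast
  moreover have "eventually (\<lambda>n. n \<in> ?S) G"
    using G(2) by (simp add: le_principal)
  ultimately have "eventually (\<lambda>_. False) G"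
    by eventually_elim simp
  then show False
    using G(1) by (simp add: trivial_limit_def)
qed

text \<open>For two cluster points, the difference of the squared distances is affine in
  \<open>x n\<close>. Hence the inner product with \<open>l' - l\<close> converges, and its limits
  along the two filters coincide, which gives \<open>l' = l\<close>.\<close>

lemma opial:
  fixes x :: "nat \<Rightarrow> 'a::{real_inner, complete_space}"
  assumes "z \<in> Z"
    and dist: "\<And>z. z \<in> Z \<Longrightarrow> convergent (\<lambda>n. (norm (x n - z))\<^sup>2)"
    and cluster: "\<And>G l. G \<noteq> bot \<Longrightarrow> G \<le> sequentially \<Longrightarrow>
      (\<And>u. ((\<lambda>n. x n \<bullet> u) \<longlongrightarrow> l \<bullet> u) G) \<Longrightarrow> l \<in> Z"
  shows "\<exists>l\<in>Z. converges_weakly x l"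
proof -
  have "Bseq (\<lambda>n. (norm (x n - z))\<^sup>2)"
    using dist[OF \<open>z \<in> Z\<close>] by (rule convergent_imp_Bseq)
  then obtain K where K: "K > 0" "\<And>n. (norm (x n - z))\<^sup>2 \<le> K"
    by (auto elim!: BseqE)
  have bounded: "norm (x n) \<le> norm z + sqrt K" for n
    using norm_triangle_sub[of "x n" z] real_le_rsqrt[OF K(2)[of n]] by linarith
  obtain G l where G: "G \<noteq> bot" "G \<le> sequentially" and l: "\<And>u. ((\<lambda>n. x n \<bullet> u) \<longlongrightarrow> l \<bullet> u) G"
    using weak_cluster_point[of sequentially x, OF _ bounded] by auto
  have "l \<in> Z"
    using cluster G l .
  moreover have "converges_weakly x l"
  proof (rule converges_weaklyI[OF bounded])
    fix G' l'
    assume G': "G' \<noteq> bot" "G' \<le> sequentially" and l': "\<And>u. ((\<lambda>n. x n \<bullet> u) \<longlongrightarrow> l' \<bullet> u) G'"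
    have "l' \<in> Z"
      using cluster G' l' .
    have "convergent (\<lambda>n. ((norm (x n - l))\<^sup>2 - (norm (x n - l'))\<^sup>2) - (l \<bullet> l - l' \<bullet> l'))"
      by (intro convergent_diff dist \<open>l \<in> Z\<close> \<open>l' \<in> Z\<close> convergent_const)
    moreover have "((norm (x n - l))\<^sup>2 - (norm (x n - l'))\<^sup>2) - (l \<bullet> l - l' \<bullet> l')
        = x n \<bullet> (2 *\<^sub>R (l' - l))" for n
      unfolding power2_norm_eq_inner by (simp add: inner_simps inner_commute)
    ultimately obtain c where c: "(\<lambda>n. x n \<bullet> (2 *\<^sub>R (l' - l))) \<longlonglongrightarrow> c"
      by (auto simp: convergent_def)
    have "c = l \<bullet> (2 *\<^sub>R (l' - l))"
      using tendsto_unique[OF G(1) tendsto_mono[OF G(2) c] l] .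
    moreover have "c = l' \<bullet> (2 *\<^sub>R (l' - l))"
      using tendsto_unique[OF G'(1) tendsto_mono[OF G'(2) c] l'] .
    ultimately have "(l' - l) \<bullet> (l' - l) = 0"
      by (simp add: inner_simps)
    then show "l' = l"
      by simp
  qed
  ultimately show ?thesis
    by blast
qed

section \<open>Resolvents of maximally monotone operators\<close>

text \<open>Monotonicity of two graph points reads as a halfspace condition on either one, with the
  other as normal. Halfspaces being convex, it extends to the hull in one argument, then in the
  other.\<close>

lemma monotone_graph_hull_ge:
  fixes G :: "('a::real_inner \<times> 'a) set"
  assumes mono: "\<And>y v y' v'. (y, v) \<in> G \<Longrightarrow> (y', v') \<in> G \<Longrightarrow> 0 \<le> (y - y') \<bullet> (v - v')"
    and hull: "(Y, V, s) \<in> convex hull ((\<lambda>(y, v). (y, v, y \<bullet> v)) ` G)"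
  shows "Y \<bullet> V \<le> s"
proof -
  let ?S = "(\<lambda>(y, v). (y, v, y \<bullet> v)) ` G"
  have generator: "- (y \<bullet> v) \<le> (- v, - y, 1) \<bullet> p" if "(y, v) \<in> G" "p \<in> convex hull ?S" for y v p
  proof -
    have "?S \<subseteq> {p. - (y \<bullet> v) \<le> (- v, - y, 1) \<bullet> p}"
      using mono[OF that(1)] by (auto simp: inner_diff inner_commute algebra_simps)
    then have "convex hull ?S \<subseteq> {p. - (y \<bullet> v) \<le> (- v, - y, 1) \<bullet> p}"
      by (intro hull_minimal convex_halfspace_ge)
    then show ?thesis
      using that(2) by blast
  qed
  \<comment> \<open>By symmetry the hull point now supplies the normal; evaluating at this same
    point gives \<open>- s \<le> s - 2 * (Y \<bullet> V)\<close>.\<close>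
  have "?S \<subseteq> {p. - s \<le> (- V, - Y, 1) \<bullet> p}"
    using generator[OF _ hull] by (auto simp: inner_commute algebra_simps)
  then have "convex hull ?S \<subseteq> {p. - s \<le> (- V, - Y, 1) \<bullet> p}"
    by (intro hull_minimal convex_halfspace_ge)
  then have "- s \<le> (- V, - Y, 1) \<bullet> (Y, V, s)"
    using hull by blast
  then show ?thesis
    by (simp add: inner_commute)
qed

text \<open>Minimizing \<open>(norm c)\<^sup>2 + t\<close> over the convex hull of the points
  \<open>((y - v) / 2, y \<bullet> v)\<close>, where it is at least \<open>(norm (Y + V))\<^sup>2 / 4\<close>, makes the first-order
  condition at the minimum the required inequality.\<close>

lemma monotone_graph_resolvent_point:
  fixes G :: "('a::{real_inner, complete_space} \<times> 'a) set"
  assumes mono: "\<And>y v y' v'. (y, v) \<in> G \<Longrightarrow> (y', v') \<in> G \<Longrightarrow> 0 \<le> (y - y') \<bullet> (v - v')"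
  obtains x where "\<And>y v. (y, v) \<in> G \<Longrightarrow> 0 \<le> (y - x) \<bullet> (v + x)"
proof (cases "G = {}")
  case True
  then show thesis
    using that by blast
next
  case False
  let ?S = "(\<lambda>(y, v). (y, v, y \<bullet> v)) ` G"
  let ?f = "\<lambda>(Y, V, s::real). ((1/2) *\<^sub>R (Y - V) :: 'a, s)"
  let ?K = "?f ` (convex hull ?S)"
  have "linear ?f"
    by (intro linearI) (auto simp: algebra_simps)
  then have convex: "convex ?K"
    by (intro convex_linear_image convex_convex_hull)
  have nonempty: "?K \<noteq> {}"
    using False by simp
  have lower: "0 \<le> (norm c)\<^sup>2 + t" if ct: "(c, t) \<in> ?K" for c t
  proof -
    obtain q where q: "q \<in> convex hull ?S" "(c, t) = ?f q"
      using ct by blast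
    then obtain Y V where YV: "(Y, V, t) \<in> convex hull ?S" and c: "c = (1/2) *\<^sub>R (Y - V)"
      by (cases q) simp
    have "0 \<le> (norm ((1/2) *\<^sub>R (Y + V)))\<^sup>2"
      by simp
    also have "\<dots> = (norm c)\<^sup>2 + Y \<bullet> V"
      unfolding c power2_norm_eq_inner by (simp add: inner_simps inner_commute field_simps)
    finally show ?thesis
      using monotone_graph_hull_ge[OF mono YV] by simp
  qed
  obtain x s where xs: "0 \<le> (norm x)\<^sup>2 + s"
    and min: "\<forall>(c, t) \<in> ?K. 0 \<le> 2 * (x \<bullet> (c - x)) + t - s"
    by (rule convex_quadratic_minimum[OF convex nonempty lower])
  have "0 \<le> (y - x) \<bullet> (v + x)" if "(y, v) \<in> G" for y v
  proof -
    have "(y, v, y \<bullet> v) \<in> convex hull ?S"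
      using that by (intro hull_inc) auto
    then have "((1/2) *\<^sub>R (y - v), y \<bullet> v) \<in> ?K"
      by (intro image_eqI) auto
    \<comment> \<open>Since \<open>s \<ge> - (norm x)\<^sup>2\<close>, the first-order condition is
      bounded above by \<open>(y - x) \<bullet> (v + x)\<close>.\<close>
    from bspec[OF min this] xs show ?thesis
      unfolding power2_norm_eq_inner by (simp add: inner_simps inner_commute algebra_simps)
  qed
  then show thesis
    using that by blast
qed

lemma monotone_opD:
  assumes "monotone_op A" "u \<in> A x" "v \<in> A y"
  shows "0 \<le> (x - y) \<bullet> (u - v)"
  using assms by (auto simp: monotone_op_def gra_def)

text \<open>Otherwise adjoining \<open>(x, u)\<close> to the graph would give a proper monotone
  extension.\<close>

lemma maximally_monotone_memI:
  assumes "maximally_monotone A" and related: "\<And>y v. v \<in> A y \<Longrightarrow> 0 \<le> (x - y) \<bullet> (u - v)"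
  shows "u \<in> A x"
proof (rule ccontr)
  assume "u \<notin> A x"
  define A' where "A' = A(x := insert u (A x))"
  have "0 \<le> (y - x) \<bullet> (v - u)" if "v \<in> A y" for y v
    using related[OF that] by (simp add: inner_diff)
  then have "monotone_op A'"
    using assms related unfolding maximally_monotone_def monotone_op_def gra_def A'_def
    by (auto split: if_splits)
  moreover have "gra A \<subset> gra A'"
    using \<open>u \<notin> A x\<close> by (auto simp: gra_def A'_def)
  ultimately show False
    using assms(1) by (auto simp: maximally_monotone_def)
qed

text \<open>Surjectivity of the identity plus \<open>c\<close> times \<open>A\<close>. The graph is
  scaled by \<open>c\<close> and shifted by \<open>z\<close>, so that the point found is
  monotonically related to all of \<open>A\<close>; maximality puts it in the graph.\<close>

lemma minty:
  fixes A :: "'a::{real_inner, complete_space} set_operator"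
  assumes A: "maximally_monotone A" and "c > 0"
  obtains p where "(1 / c) *\<^sub>R (z - p) \<in> A p"
proof -
  define G where "G = {(y, c *\<^sub>R v - z) | y v. v \<in> A y}"
  have "0 \<le> (y - y') \<bullet> (w - w')" if G: "(y, w) \<in> G" "(y', w') \<in> G" for y w y' w'
  proof -
    obtain v v' where v: "v \<in> A y" "v' \<in> A y'" "w = c *\<^sub>R v - z" "w' = c *\<^sub>R v' - z"
      using G by (auto simp: G_def)
    then have "0 \<le> c * ((y - y') \<bullet> (v - v'))"
      using A monotone_opD[of A v y v' y'] \<open>c > 0\<close> by (simp add: maximally_monotone_def)
    also have "\<dots> = (y - y') \<bullet> (w - w')"
      by (simp add: v inner_simps algebra_simps)
    finally show ?thesis .
  qed
  then obtain p where p: "\<And>y w. (y, w) \<in> G \<Longrightarrow> 0 \<le> (y - p) \<bullet> (w + p)"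
    using monotone_graph_resolvent_point[of G] by blast
  have "0 \<le> (p - y) \<bullet> ((1 / c) *\<^sub>R (z - p) - v)" if "v \<in> A y" for y v
  proof -
    have "0 \<le> (1 / c) * ((y - p) \<bullet> (c *\<^sub>R v - z + p))"
      using p[of y "c *\<^sub>R v - z"] that \<open>c > 0\<close> by (auto simp: G_def)
    also have "\<dots> = (p - y) \<bullet> ((1 / c) *\<^sub>R (z - p) - v)"
      using \<open>c > 0\<close> by (simp add: inner_simps inner_commute field_simps)
    finally show ?thesis .
  qed
  then show thesis
    using that maximally_monotone_memI[OF A] by blast
qed

lemma resolvent_op_scale_op:
  assumes "c > 0"
  shows "p \<in> resolvent_op (scale_op c A) z \<longleftrightarrow> (1 / c) *\<^sub>R (z - p) \<in> A p"
proof -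
  have "z = p + c *\<^sub>R u \<longleftrightarrow> (1 / c) *\<^sub>R (z - p) = u" for u
  proof -
    have "z = p + c *\<^sub>R u \<longleftrightarrow> z - p = c *\<^sub>R u"
      by (simp add: diff_eq_eq add.commute)
    also have "\<dots> \<longleftrightarrow> (1 / c) *\<^sub>R (z - p) = u"
      using assms by auto
    finally show ?thesis .
  qed
  then have "(\<exists>u\<in>A p. z = p + c *\<^sub>R u) \<longleftrightarrow> (1 / c) *\<^sub>R (z - p) \<in> A p"
    by simp
  then show ?thesis
    by (auto simp: resolvent_op_def inverse_op_def sum_op_def single_op_def scale_op_def set_plus_def)
qed

text \<open>Monotonicity gives
  \<open>(norm (p - q))\<^sup>2 \<le> (p - q) \<bullet> (z - w)\<close>, and Cauchy-Schwarz
  finishes. With \<open>z = w\<close> this is uniqueness of the resolvent point.\<close>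

lemma scaled_resolvent_nonexpansive:
  assumes "monotone_op A" "c > 0"
    and p: "(1 / c) *\<^sub>R (z - p) \<in> A p" and q: "(1 / c) *\<^sub>R (w - q) \<in> A q"
  shows "norm (p - q) \<le> norm (z - w)"
proof -
  have "0 \<le> c * ((p - q) \<bullet> ((1 / c) *\<^sub>R (z - p) - (1 / c) *\<^sub>R (w - q)))"
    using monotone_opD[OF assms(1) p q] \<open>c > 0\<close> by simp
  also have "\<dots> = (p - q) \<bullet> (z - w) - (norm (p - q))\<^sup>2"
    using \<open>c > 0\<close> unfolding power2_norm_eq_inner by (simp add: inner_simps field_simps)
  finally have "norm (p - q) * norm (p - q) \<le> norm (p - q) * norm (z - w)"
    using norm_cauchy_schwarz[of "p - q" "z - w"] by (simp add: power2_eq_square)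
  then show ?thesis
    by (cases "p = q") (auto simp: mult_le_cancel_left)
qed

text \<open>Existence by Minty and uniqueness by nonexpansiveness make the resolvent set a
  singleton, so \<open>the_elem\<close> returns its point.\<close>

lemma resolvent_scale_op:
  fixes A :: "'a::{real_inner, complete_space} set_operator"
  assumes A: "maximally_monotone A" and "c > 0"
  shows "(1 / c) *\<^sub>R (z - resolvent (scale_op c A) z) \<in> A (resolvent (scale_op c A) z)"
proof -
  obtain p where p: "(1 / c) *\<^sub>R (z - p) \<in> A p"
    using minty[OF assms] by metis
  have "q = p" if "(1 / c) *\<^sub>R (z - q) \<in> A q" for q
    using scaled_resolvent_nonexpansive[OF _ \<open>c > 0\<close> that p] A by (simp add: maximally_monotone_def)
  then have "resolvent_op (scale_op c A) z = {p}"
    using p resolvent_op_scale_op[OF \<open>c > 0\<close>] by blast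
  then show ?thesis
    using p by (simp add: resolvent_def)
qed

text \<open>A Banach fixed point provides, for some small \<open>c\<close>, the range condition for
  \<open>A\<close> plus \<open>M\<close>; it replaces a proof that this sum is maximal.\<close>

lemma perturbed_resolvent_exists:
  fixes A :: "'a::{real_inner, complete_space} set_operator"
  assumes A: "maximally_monotone A" and M: "L-lipschitz_on UNIV M"
  obtains c y v where "c > 0" "v \<in> A y" "y + c *\<^sub>R (v + M y) = z"
proof -
  have "L \<ge> 0"
    using M by (rule lipschitz_on_nonneg)
  \<comment> \<open>with this \<open>c\<close> the map \<open>y \<mapsto> J\<^bsub>cA\<^esub> (z - c M y)\<close> is a contraction\<close>
  define c where "c = 1 / (2 * (L + 1))"
  have c: "c > 0" "c * L \<le> 1 / 2"
    using \<open>L \<ge> 0\<close> by (auto simp: c_def field_simps)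
  let ?J = "resolvent (scale_op c A)"
  have "dist (?J (z - c *\<^sub>R M y)) (?J (z - c *\<^sub>R M y')) \<le> 1 / 2 * dist y y'" for y y'
  proof -
    have "dist (?J (z - c *\<^sub>R M y)) (?J (z - c *\<^sub>R M y')) \<le> norm (c *\<^sub>R (M y' - M y))"
      using scaled_resolvent_nonexpansive[where A = A, OF _ c(1)
          resolvent_scale_op[OF A c(1), of "z - c *\<^sub>R M y"]
          resolvent_scale_op[OF A c(1), of "z - c *\<^sub>R M y'"]] A
      by (simp add: maximally_monotone_def dist_norm algebra_simps)
    also have "\<dots> = c * dist (M y) (M y')"
      using c(1) by (simp add: dist_norm norm_minus_commute)
    also have "\<dots> \<le> c * (L * dist y y')"
      using c(1) lipschitz_onD[OF M] by (intro mult_left_mono) auto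
    also have "\<dots> \<le> 1 / 2 * dist y y'"
      using mult_right_mono[OF c(2), of "dist y y'"] by (simp add: mult.assoc)
    finally show ?thesis .
  qed
  then obtain y where y: "?J (z - c *\<^sub>R M y) = y"
    using banach_fix_type[of "1/2" "\<lambda>y. ?J (z - c *\<^sub>R M y)"] by auto
  have "(1 / c) *\<^sub>R (z - c *\<^sub>R M y - y) \<in> A y"
    using resolvent_scale_op[OF A c(1), of "z - c *\<^sub>R M y"] unfolding y .
  moreover have "y + c *\<^sub>R ((1 / c) *\<^sub>R (z - c *\<^sub>R M y - y) + M y) = z"
    using c(1) by (simp add: algebra_simps)
  ultimately show thesis
    using that c(1) by blast
qed

text \<open>Monotonicity of the sum is tested between \<open>p i\<close> and the point
  \<open>y\<close> with \<open>y + c *\<^sub>R (v + M y) = l\<close>. Pairing a bounded with a null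
  family, the limit is \<open>0 \<le> - c * (norm (v + M y))\<^sup>2\<close>, so
  \<open>y = l\<close> and \<open>v = - M l\<close>.\<close>

lemma monotone_sum_demiclosed:
  fixes A :: "'a::{real_inner, complete_space} set_operator"
  assumes A: "maximally_monotone A" and M: "L-lipschitz_on UNIV M"
    and M_mono: "\<And>x y. 0 \<le> (x - y) \<bullet> (M x - M y)"
    and "F \<noteq> bot" and bounded: "\<And>i. norm (p i) \<le> R"
    and weak: "\<And>u. ((\<lambda>i. p i \<bullet> u) \<longlongrightarrow> l \<bullet> u) F"
    and w: "\<And>i. w i \<in> A (p i)" and null: "((\<lambda>i. w i + M (p i)) \<longlongrightarrow> 0) F"
  shows "- M l \<in> A l"
proof -
  obtain c y v where c: "c > 0" and v: "v \<in> A y" and y: "y + c *\<^sub>R (v + M y) = l"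
    by (rule perturbed_resolvent_exists[OF A M])
  have pos: "0 \<le> (p i - y) \<bullet> (w i + M (p i)) - (p i \<bullet> (v + M y) - y \<bullet> (v + M y))" for i
    using M_mono[of "p i" y] monotone_opD[OF _ w v, of i] A
    by (simp add: maximally_monotone_def inner_simps)
  have "((\<lambda>i. (p i - y) \<bullet> (w i + M (p i))) \<longlongrightarrow> 0) F"
  proof (rule tendsto_0_le[OF null])
    have "norm ((p i - y) \<bullet> (w i + M (p i))) \<le> norm (w i + M (p i)) * (R + norm y)" for i
    proof -
      have "norm ((p i - y) \<bullet> (w i + M (p i))) \<le> norm (p i - y) * norm (w i + M (p i))"
        by (simp add: Cauchy_Schwarz_ineq2)
      also have "\<dots> \<le> (R + norm y) * norm (w i + M (p i))"
        using norm_triangle_ineq4[of "p i" y] bounded[of i] by (intro mult_right_mono) auto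
      finally show ?thesis
        by (simp add: mult.commute)
    qed
    then show "\<forall>\<^sub>F i in F. norm ((p i - y) \<bullet> (w i + M (p i))) \<le> norm (w i + M (p i)) * (R + norm y)"
      by simp
  qed
  then have "((\<lambda>i. (p i - y) \<bullet> (w i + M (p i)) - (p i \<bullet> (v + M y) - y \<bullet> (v + M y)))
      \<longlongrightarrow> 0 - (l \<bullet> (v + M y) - y \<bullet> (v + M y))) F"
    by (intro tendsto_intros weak)
  then have "0 \<le> 0 - (l \<bullet> (v + M y) - y \<bullet> (v + M y))"
    using pos \<open>F \<noteq> bot\<close> by (intro tendsto_lowerbound) auto
  also have "\<dots> = - (c * (norm (v + M y))\<^sup>2)"
    unfolding y[symmetric] power2_norm_eq_inner by (simp add: inner_simps algebra_simps)
  finally have "v + M y = 0"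
    using c by (simp add: mult_le_0_iff)
  then show ?thesis
    using v y by (simp add: eq_neg_iff_add_eq_0[symmetric])
qed

lemma mem_zer_sum_iff:
  fixes A :: "'a::real_vector set_operator"
  shows "l \<in> zer (sum_op (sum_op A (single_op B)) (single_op C)) \<longleftrightarrow> - (B l + C l) \<in> A l"
proof -
  have "l \<in> zer (sum_op (sum_op A (single_op B)) (single_op C)) \<longleftrightarrow> (\<exists>u\<in>A l. u + (B l + C l) = 0)"
    by (auto simp: zer_def sum_op_def single_op_def set_plus_def add.assoc)
  then show ?thesis
    by (auto simp: eq_neg_iff_add_eq_0[symmetric])
qed

section \<open>The energy inequality\<close>

lemma convergent_of_decrease:
  fixes T q :: "nat \<Rightarrow> real"
  assumes "\<delta> > 0" and T: "\<And>n. 0 \<le> T n" and q: "\<And>n. 0 \<le> q n"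
    and decrease: "\<And>n. T (Suc n) \<le> T n - \<delta> * q n"
  shows "convergent T" "q \<longlonglongrightarrow> 0"
proof -
  have "T (Suc n) \<le> T n" for n
    using decrease[of n] mult_nonneg_nonneg[OF less_imp_le[OF \<open>\<delta> > 0\<close>] q[of n]] by linarith
  then obtain t where t: "T \<longlonglongrightarrow> t"
    using decseq_convergent[of T 0] T decseq_SucI[of T] by metis
  then show "convergent T"
    by (auto simp: convergent_def)
  have "(\<lambda>n. (T n - T (Suc n)) / \<delta>) \<longlonglongrightarrow> (t - t) / \<delta>"
    using \<open>\<delta> > 0\<close> by (intro tendsto_intros t LIMSEQ_Suc) auto
  then have upper: "(\<lambda>n. (T n - T (Suc n)) / \<delta>) \<longlonglongrightarrow> 0"
    by simp
  have "q n \<le> (T n - T (Suc n)) / \<delta>" for n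
    using decrease[of n] \<open>\<delta> > 0\<close> by (simp add: field_simps)
  then show "q \<longlonglongrightarrow> 0"
    using q by (intro tendsto_sandwich[OF _ _ tendsto_const upper]) auto
qed

text \<open>Here \<open>h\<close> is the lag between the point where the cocoercive operator is
  evaluated and the point of testing. Expanding the square of \<open>2 * \<beta> * c + h\<close>
  pays for it.\<close>

lemma cocoercive_cross_term:
  fixes a c h :: "'a::real_inner"
  assumes "\<beta> > 0" "\<gamma> > 0" and c: "\<beta> * (norm c)\<^sup>2 \<le> a \<bullet> c"
  shows "- 2 * \<gamma> * ((a + h) \<bullet> c) \<le> \<gamma> / (2 * \<beta>) * (norm h)\<^sup>2"
proof -
  have "0 \<le> (norm ((2 * \<beta>) *\<^sub>R c + h))\<^sup>2"
    by simp
  also have "\<dots> = 4 * \<beta> * (\<beta> * (norm c)\<^sup>2) + 4 * \<beta> * (h \<bullet> c) + (norm h)\<^sup>2"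
    unfolding power2_norm_eq_inner by (simp add: inner_simps inner_commute algebra_simps)
  also have "\<dots> \<le> 4 * \<beta> * (a \<bullet> c) + 4 * \<beta> * (h \<bullet> c) + (norm h)\<^sup>2"
    using c \<open>\<beta> > 0\<close> by simp
  finally have "- (4 * \<beta> * ((a + h) \<bullet> c)) \<le> (norm h)\<^sup>2"
    by (simp add: inner_simps algebra_simps)
  then have "\<gamma> / (2 * \<beta>) * - (4 * \<beta> * ((a + h) \<bullet> c)) \<le> \<gamma> / (2 * \<beta>) * (norm h)\<^sup>2"
    using assms by (intro mult_left_mono) auto
  then show ?thesis
    using \<open>\<beta> > 0\<close> by (simp add: field_simps)
qed

text \<open>The weights balance the energy estimate: \<open>sqrt 2\<close> on \<open>h\<close>,
  together with the weight 1 that the energy keeps on its \<open>e\<close>-term, equals the weight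
  \<open>1 + sqrt 2\<close> on \<open>d\<close>.\<close>

lemma reflection_cross_term:
  fixes d e g h :: "'a::real_inner"
  assumes "\<mu> > 0" and g: "norm g \<le> \<mu> * norm (d + e)"
  shows "2 * (h \<bullet> g) \<le> \<mu> * (sqrt 2 * (norm h)\<^sup>2 + (1 + sqrt 2) * (norm d)\<^sup>2 + (norm e)\<^sup>2)"
proof -
  define s where "s = sqrt (2::real)"
  have s: "s * s = 2" "s > 0"
    by (auto simp: s_def)
  have "h \<bullet> g \<le> norm h * (\<mu> * (norm d + norm e))"
  proof -
    have "norm g \<le> \<mu> * (norm d + norm e)"
      using g mult_left_mono[OF norm_triangle_ineq[of d e], of \<mu>] \<open>\<mu> > 0\<close> by linarith
    then show ?thesis
      using norm_cauchy_schwarz[of h g] mult_left_mono[of "norm g" _ "norm h"]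
      by (meson norm_ge_zero order_trans)
  qed
  moreover have "2 * (H * (D + E)) \<le> s * H\<^sup>2 + (1 + s) * D\<^sup>2 + E\<^sup>2" for H D E :: real
  proof -
    \<comment> \<open>This is the slack in \<open>(D + E)\<^sup>2 \<le> s * (1 + s) * D\<^sup>2 + s
      * E\<^sup>2\<close>; since \<open>(s - 1) * (1 + s) = 1\<close>, it is a multiple of a
      square.\<close>
    define r where "r = (1 + s) * D\<^sup>2 + (s - 1) * E\<^sup>2 - 2 * (D * E)"
    have "(s - 1) * r = (D - (s - 1) * E)\<^sup>2 + (s * s - 2) * D\<^sup>2"
      by (simp add: r_def power2_eq_square algebra_simps)
    then have "0 \<le> (s - 1) * r"
      using s(1) by simp
    moreover have "s - 1 > 0"
      by (simp add: s_def)
    ultimately have "0 \<le> r"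
      by (simp add: zero_le_mult_iff)
    moreover have "s * (s * H\<^sup>2 + (1 + s) * D\<^sup>2 + E\<^sup>2 - 2 * (H * (D + E)))
        = (s * H - (D + E))\<^sup>2 + r + (s * s - 2) * D\<^sup>2"
      by (simp add: r_def power2_eq_square algebra_simps)
    ultimately have "0 \<le> s * (s * H\<^sup>2 + (1 + s) * D\<^sup>2 + E\<^sup>2 - 2 * (H * (D + E)))"
      using s(1) by simp
    then show ?thesis
      using s(2) by (simp add: zero_le_mult_iff)
  qed
  from mult_left_mono[OF this[of "norm h" "norm d" "norm e"], of \<mu>]
  have "2 * (norm h * (\<mu> * (norm d + norm e)))
      \<le> \<mu> * (s * (norm h)\<^sup>2 + (1 + s) * (norm d)\<^sup>2 + (norm e)\<^sup>2)"
    using \<open>\<mu> > 0\<close> by (simp add: mult_ac)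
  ultimately show ?thesis
    unfolding s_def by linarith
qed

text \<open>At step \<open>n\<close> the arguments are \<open>a = x\<^bsub>n+1\<^esub> - z\<close>, \<open>d = x\<^bsub>n+1\<^esub> - x\<^sub>n\<close>,
  \<open>e = x\<^bsub>n+1\<^esub> - y\<^sub>n\<close>, \<open>b = B y\<^sub>n - B z\<close> for a zero \<open>z\<close>, and \<open>L = \<gamma>\<mu>\<close>; a prime marks
  the quantity at the next step, where \<open>e' = d' - d\<close>.\<close>

definition lyapunov :: "real \<Rightarrow> real \<Rightarrow> 'a::real_inner \<Rightarrow> 'a \<Rightarrow> 'a \<Rightarrow> 'a \<Rightarrow> real" where
  "lyapunov \<gamma> L a d e b = (norm a)\<^sup>2 + (norm d)\<^sup>2 + 2 * \<gamma> * (b \<bullet> d)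
     + L * (1 + sqrt 2) * (norm d)\<^sup>2 + L * (norm e)\<^sup>2"

text \<open>Only the term \<open>b \<bullet> d\<close> can be negative. As \<open>b\<close> is
  bounded through \<open>a - e\<close>, Young's inequality charges it to \<open>a\<close>,
  \<open>d\<close> and \<open>e\<close>, and the extra terms of the energy absorb the
  \<open>e\<close>-part and one \<open>d\<close>-part.\<close>

lemma lyapunov_ge:
  assumes "\<gamma> > 0" "\<mu> > 0" and b: "norm b \<le> \<mu> * norm (a - e)"
  shows "(1 - \<gamma> * \<mu>) * ((norm a)\<^sup>2 + (norm d)\<^sup>2) \<le> lyapunov \<gamma> (\<gamma> * \<mu>) a d e b"
proof -
  have "- (b \<bullet> d) \<le> norm b * norm d"
    using norm_cauchy_schwarz[of "- b" d] by simp
  also have "\<dots> \<le> (\<mu> * (norm a + norm e)) * norm d"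
  proof (rule mult_right_mono)
    show "norm b \<le> \<mu> * (norm a + norm e)"
      using b mult_left_mono[OF norm_triangle_ineq4[of a e], of \<mu>] \<open>\<mu> > 0\<close> by linarith
  qed simp
  finally have "2 * \<gamma> * - (b \<bullet> d) \<le> 2 * \<gamma> * ((\<mu> * (norm a + norm e)) * norm d)"
    using \<open>\<gamma> > 0\<close> by (intro mult_left_mono) auto
  also have "\<dots> = \<gamma> * \<mu> * (2 * (norm a * norm d) + 2 * (norm e * norm d))"
    by (simp add: algebra_simps)
  also have "\<dots> \<le> \<gamma> * \<mu> * (((norm a)\<^sup>2 + (norm d)\<^sup>2) + ((norm e)\<^sup>2 + (norm d)\<^sup>2))"
    using sum_squares_bound[of "norm a" "norm d"] sum_squares_bound[of "norm e" "norm d"] assms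
    by (intro mult_left_mono add_mono) (auto simp: mult.assoc)
  finally have "2 * \<gamma> * - (b \<bullet> d) \<le> \<gamma> * \<mu> * (((norm a)\<^sup>2 + (norm d)\<^sup>2) + ((norm e)\<^sup>2 + (norm d)\<^sup>2))" .
  moreover have "0 \<le> \<gamma> * \<mu> * sqrt 2 * (norm d)\<^sup>2"
    using assms by simp
  ultimately show ?thesis
    unfolding lyapunov_def by (simp add: algebra_simps)
qed

lemma lyapunov_decrease:
  fixes a d e d' b b' c g :: "'a::real_inner"
  assumes pos: "\<gamma> > 0" "\<mu> > 0" "\<beta> > 0"
    and zero: "0 \<le> (a + d') \<bullet> (- d' - \<gamma> *\<^sub>R b' - \<gamma> *\<^sub>R c)"
    and consecutive: "0 \<le> d' \<bullet> (d - d' - \<gamma> *\<^sub>R (b' - b) - \<gamma> *\<^sub>R g)"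
    and b': "0 \<le> (a + d) \<bullet> b'" and lip: "norm (b' - b) \<le> \<mu> * norm (d + e)"
    and c: "\<beta> * (norm c)\<^sup>2 \<le> a \<bullet> c" and g: "\<beta> * (norm g)\<^sup>2 \<le> d \<bullet> g"
  shows "lyapunov \<gamma> (\<gamma> * \<mu>) (a + d') d' (d' - d) b'
    \<le> lyapunov \<gamma> (\<gamma> * \<mu>) a d e b
      - (1 - \<gamma> / (2 * \<beta>) - \<gamma> * \<mu> * (1 + sqrt 2)) * ((norm d')\<^sup>2 + (norm (d' - d))\<^sup>2)"
proof -
  define s where "s = sqrt (2::real)"
  define \<rho> where "\<rho> = \<gamma> / (2 * \<beta>)"
  have cross_c: "- 2 * \<gamma> * ((a + d') \<bullet> c) \<le> \<rho> * (norm d')\<^sup>2"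
    unfolding \<rho>_def using pos c by (intro cocoercive_cross_term)
  have cross_g: "- 2 * \<gamma> * (d' \<bullet> g) \<le> \<rho> * (norm (d' - d))\<^sup>2"
    unfolding \<rho>_def using cocoercive_cross_term[OF pos(3) pos(1) g, of "d' - d"] by simp
  have "\<gamma> * (2 * ((d - d') \<bullet> (b' - b)))
      \<le> \<gamma> * (\<mu> * (s * (norm (d - d'))\<^sup>2 + (1 + s) * (norm d)\<^sup>2 + (norm e)\<^sup>2))"
    unfolding s_def using pos lip by (intro mult_left_mono reflection_cross_term) auto
  then have cross_b: "2 * \<gamma> * ((d - d') \<bullet> (b' - b))
      \<le> \<gamma> * \<mu> * s * (norm (d' - d))\<^sup>2 + \<gamma> * \<mu> * (1 + s) * (norm d)\<^sup>2 + \<gamma> * \<mu> * (norm e)\<^sup>2"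
    by (simp add: norm_minus_commute algebra_simps)
  \<comment> \<open>With these weights the \<open>B\<close>-terms reduce to the telescoping
    \<open>b \<bullet> d\<close> and \<open>b' \<bullet> d'\<close> plus one cross term, which the
    Lipschitz bound controls.\<close>
  have "0 \<le> 2 * ((a + d') \<bullet> (- d' - \<gamma> *\<^sub>R b' - \<gamma> *\<^sub>R c))
      + 2 * (d' \<bullet> (d - d' - \<gamma> *\<^sub>R (b' - b) - \<gamma> *\<^sub>R g)) + 2 * \<gamma> * ((a + d) \<bullet> b')"
    using zero consecutive b' pos by simp
  also have "\<dots> = (norm a)\<^sup>2 + (norm d)\<^sup>2 - (norm (a + d'))\<^sup>2 - 2 * (norm d')\<^sup>2 - (norm (d' - d))\<^sup>2
      + 2 * \<gamma> * (b \<bullet> d) - 2 * \<gamma> * (b' \<bullet> d') + 2 * \<gamma> * ((d - d') \<bullet> (b' - b))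
      - 2 * \<gamma> * ((a + d') \<bullet> c) - 2 * \<gamma> * (d' \<bullet> g)"
    unfolding power2_norm_eq_inner by (simp add: inner_simps inner_commute algebra_simps)
  finally show ?thesis
    using cross_b cross_c cross_g unfolding lyapunov_def s_def[symmetric] \<rho>_def[symmetric]
    by (simp add: algebra_simps)
qed

section \<open>Convergence of the iteration\<close>

lemma cocoercive_imp_lipschitz:
  assumes "cocoercive \<beta> C" "\<beta> > 0"
  shows "(1 / \<beta>)-lipschitz_on UNIV C"
proof (rule lipschitz_onI)
  fix x y
  have "\<beta> * (norm (C x - C y))\<^sup>2 \<le> norm (x - y) * norm (C x - C y)"
    using assms(1) norm_cauchy_schwarz[of "x - y" "C x - C y"]
    unfolding cocoercive_def by (meson order_trans)
  then have "\<beta> * norm (C x - C y) \<le> norm (x - y)"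
    by (cases "C x = C y") (auto simp: power2_eq_square mult.assoc[symmetric])
  then show "dist (C x) (C y) \<le> 1 / \<beta> * dist x y"
    using \<open>\<beta> > 0\<close> by (simp add: dist_norm field_simps)
qed (use assms in simp)

lemma lipschitz_diff_tendsto_0:
  fixes B :: "'a::real_normed_vector \<Rightarrow> 'b::real_normed_vector"
  assumes "L-lipschitz_on UNIV B" "((\<lambda>i. p i - q i) \<longlongrightarrow> 0) F"
  shows "((\<lambda>i. B (p i) - B (q i)) \<longlongrightarrow> 0) F"
proof (rule tendsto_0_le[OF assms(2)])
  show "\<forall>\<^sub>F i in F. norm (B (p i) - B (q i)) \<le> norm (p i - q i) * L"
    using lipschitz_onD[OF assms(1)] by (simp add: dist_norm mult.commute)
qed

lemma tendsto_0_of_norm_sum_squares: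
  assumes "(\<lambda>n. (norm (f n))\<^sup>2 + (norm (g n))\<^sup>2) \<longlonglongrightarrow> 0"
  shows "f \<longlonglongrightarrow> 0"
proof -
  have "(\<lambda>n. (norm (f n))\<^sup>2) \<longlonglongrightarrow> 0"
    by (rule tendsto_sandwich[OF _ _ tendsto_const assms]) auto
  then have "(\<lambda>n. sqrt ((norm (f n))\<^sup>2)) \<longlonglongrightarrow> sqrt 0"
    by (rule tendsto_real_sqrt)
  then show ?thesis
    by (simp add: tendsto_norm_zero_iff)
qed

locale reflected_forward_backward =
  fixes A :: "'a::{real_inner, complete_space} set_operator"
    and B C :: "'a \<Rightarrow> 'a"
    and \<mu> \<beta> \<gamma> :: real
    and X Y :: "nat \<Rightarrow> 'a"
  assumes pos: "\<mu> > 0" "\<beta> > 0" "\<gamma> > 0"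
    and A: "maximally_monotone A"
    and B_mono: "\<And>x y. 0 \<le> (x - y) \<bullet> (B x - B y)"
    and B_lip: "\<mu>-lipschitz_on UNIV B"
    and C: "cocoercive \<beta> C"
    and step: "\<gamma> / (2 * \<beta>) + \<gamma> * \<mu> * (1 + sqrt 2) < 1"
    and Y: "\<And>n. Y (Suc n) = 2 *\<^sub>R X (Suc n) - X n"
    and X: "\<And>n. (1 / \<gamma>) *\<^sub>R (X n - \<gamma> *\<^sub>R B (Y n) - \<gamma> *\<^sub>R C (X n) - X (Suc n)) \<in> A (X (Suc n))"
begin

text \<open>The index is shifted by one because \<open>X 1\<close> is the first iterate with a known
  element of \<open>A\<close>; comparing consecutive iterates through monotonicity starts
  there.\<close>

definition "energy z n = lyapunov \<gamma> (\<gamma> * \<mu>) (X (Suc n) - z) (X (Suc n) - X n) (X (Suc n) - Y n) (B (Y n) - B z)"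

lemma B_norm: "norm (B x - B y) \<le> \<mu> * norm (x - y)"
  using lipschitz_onD[OF B_lip] by (simp add: dist_norm)

lemma step_less: "\<gamma> * \<mu> < 1"
proof -
  have "\<gamma> * \<mu> * 1 \<le> \<gamma> * \<mu> * (1 + sqrt 2)"
    using pos by (intro mult_left_mono) auto
  moreover have "0 < \<gamma> / (2 * \<beta>)"
    using pos by simp
  ultimately show ?thesis
    using step by linarith
qed

lemma energy_ge: "(1 - \<gamma> * \<mu>) * ((norm (X (Suc n) - z))\<^sup>2 + (norm (X (Suc n) - X n))\<^sup>2) \<le> energy z n"
  unfolding energy_def using pos B_norm[of "Y n" z] by (intro lyapunov_ge) (auto simp: algebra_simps)

lemma energy_nonneg: "0 \<le> energy z n"
  using step_less by (intro order_trans[OF _ energy_ge] mult_nonneg_nonneg) auto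

lemma energy_decrease:
  assumes "- (B z + C z) \<in> A z"
  shows "energy z (Suc n) \<le> energy z n - (1 - \<gamma> / (2 * \<beta>) - \<gamma> * \<mu> * (1 + sqrt 2)) *
    ((norm (X (Suc (Suc n)) - X (Suc n)))\<^sup>2 + (norm (X (Suc (Suc n)) - Y (Suc n)))\<^sup>2)"
proof -
  let ?a = "X (Suc n) - z" and ?d = "X (Suc n) - X n" and ?d' = "X (Suc (Suc n)) - X (Suc n)"
    and ?e = "X (Suc n) - Y n"
    and ?b = "B (Y n) - B z" and ?b' = "B (Y (Suc n)) - B z"
    and ?c = "C (X (Suc n)) - C z" and ?g = "C (X (Suc n)) - C (X n)"
  have mono: "0 \<le> (x - y) \<bullet> (\<gamma> *\<^sub>R (u - v))" if "u \<in> A x" "v \<in> A y" for x y u v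
    using monotone_opD[OF _ that] A pos by (simp add: maximally_monotone_def)
  have "0 \<le> (?a + ?d') \<bullet> (- ?d' - \<gamma> *\<^sub>R ?b' - \<gamma> *\<^sub>R ?c)"
    using mono[OF X[of "Suc n"] assms] pos by (simp add: algebra_simps)
  moreover have "0 \<le> ?d' \<bullet> (?d - ?d' - \<gamma> *\<^sub>R (?b' - ?b) - \<gamma> *\<^sub>R ?g)"
    using mono[OF X[of "Suc n"] X[of n]] pos by (simp add: algebra_simps)
  \<comment> \<open>By the reflection, \<open>?a + ?d\<close> is \<open>Y (Suc n) - z\<close> and
    \<open>?d + ?e\<close> is \<open>Y (Suc n) - Y n\<close>.\<close>
  moreover have "0 \<le> (?a + ?d) \<bullet> ?b'"
    using B_mono[of "Y (Suc n)" z] by (simp add: Y algebra_simps scaleR_2)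
  moreover have "norm (?b' - ?b) \<le> \<mu> * norm (?d + ?e)"
    using B_norm[of "Y (Suc n)" "Y n"] by (simp add: Y algebra_simps scaleR_2)
  moreover have "\<beta> * (norm ?c)\<^sup>2 \<le> ?a \<bullet> ?c" "\<beta> * (norm ?g)\<^sup>2 \<le> ?d \<bullet> ?g"
    using C by (auto simp: cocoercive_def)
  ultimately have "lyapunov \<gamma> (\<gamma> * \<mu>) (?a + ?d') ?d' (?d' - ?d) ?b'
    \<le> lyapunov \<gamma> (\<gamma> * \<mu>) ?a ?d ?e ?b
      - (1 - \<gamma> / (2 * \<beta>) - \<gamma> * \<mu> * (1 + sqrt 2)) * ((norm ?d')\<^sup>2 + (norm (?d' - ?d))\<^sup>2)"
    by (intro lyapunov_decrease pos)
  moreover have "?a + ?d' = X (Suc (Suc n)) - z" "?d' - ?d = X (Suc (Suc n)) - Y (Suc n)"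
    by (auto simp: Y scaleR_2)
  ultimately show ?thesis
    unfolding energy_def by simp
qed

lemma
  assumes z: "- (B z + C z) \<in> A z"
  shows energy_convergent: "convergent (energy z)"
    and X_diff_tendsto_0: "(\<lambda>n. X (Suc n) - X n) \<longlonglongrightarrow> 0"
    and X_Y_diff_tendsto_0: "(\<lambda>n. X (Suc n) - Y n) \<longlonglongrightarrow> 0"
proof -
  have "0 < 1 - \<gamma> / (2 * \<beta>) - \<gamma> * \<mu> * (1 + sqrt 2)"
    using step by simp
  note * = convergent_of_decrease[of _ "energy z"
      "\<lambda>n. (norm (X (Suc (Suc n)) - X (Suc n)))\<^sup>2 + (norm (X (Suc (Suc n)) - Y (Suc n)))\<^sup>2",
      OF this energy_nonneg _ energy_decrease[OF z], simplified]
  show "convergent (energy z)"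
    by (rule *(1))
  show "(\<lambda>n. X (Suc n) - X n) \<longlonglongrightarrow> 0"
    by (rule LIMSEQ_imp_Suc) (rule tendsto_0_of_norm_sum_squares[OF *(2)])
  have "(\<lambda>n. (norm (X (Suc (Suc n)) - Y (Suc n)))\<^sup>2 + (norm (X (Suc (Suc n)) - X (Suc n)))\<^sup>2) \<longlonglongrightarrow> 0"
    using *(2) by (simp add: add.commute)
  then show "(\<lambda>n. X (Suc n) - Y n) \<longlonglongrightarrow> 0"
    by (rule LIMSEQ_imp_Suc[OF tendsto_0_of_norm_sum_squares])
qed

lemma X_bounded:
  assumes z: "- (B z + C z) \<in> A z"
  obtains R where "\<And>n. norm (X (Suc n) - z) \<le> R"
proof -
  obtain K where K: "\<forall>n. \<bar>energy z n\<bar> \<le> K"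
    using convergent_imp_Bseq[OF energy_convergent[OF z]] by (auto simp: Bseq_def)
  have "norm (X (Suc n) - z) \<le> sqrt (K / (1 - \<gamma> * \<mu>))" for n
  proof (rule real_le_rsqrt)
    have "(1 - \<gamma> * \<mu>) * (norm (X (Suc n) - z))\<^sup>2
        \<le> (1 - \<gamma> * \<mu>) * ((norm (X (Suc n) - z))\<^sup>2 + (norm (X (Suc n) - X n))\<^sup>2)"
      using step_less by (intro mult_left_mono) auto
    also have "\<dots> \<le> K"
      using energy_ge[of n z] spec[OF K, of n] by linarith
    finally show "(norm (X (Suc n) - z))\<^sup>2 \<le> K / (1 - \<gamma> * \<mu>)"
      using step_less by (simp add: field_simps)
  qed
  then show thesis
    using that by blast
qed

text \<open>All terms of the energy other than \<open>(norm (X (Suc n) - z))\<^sup>2\<close> tend to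
  zero, so the squared distance inherits the limit of the energy.\<close>

lemma norm_diff_convergent:
  assumes z: "- (B z + C z) \<in> A z"
  shows "convergent (\<lambda>n. (norm (X (Suc n) - z))\<^sup>2)"
proof -
  obtain R where R: "\<And>n. norm (X (Suc n) - z) \<le> R"
    using X_bounded[OF z] by metis
  obtain t where t: "energy z \<longlonglongrightarrow> t"
    using energy_convergent[OF z] by (auto simp: convergent_def)
  note D = X_diff_tendsto_0[OF z] and E = X_Y_diff_tendsto_0[OF z]
  have "(\<lambda>n. Y n - X (Suc n)) \<longlonglongrightarrow> 0"
    using tendsto_minus[OF E] by simp
  \<comment> \<open>The factor \<open>B (Y n) - B z\<close> is split at
    \<open>B (X (Suc n))\<close>: the first difference is null and the second is bounded because the
    iterates are.\<close>
  note BY = tendsto_inner[OF lipschitz_diff_tendsto_0[OF B_lip this] D]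
  have BX: "(\<lambda>n. (B (X (Suc n)) - B z) \<bullet> (X (Suc n) - X n)) \<longlonglongrightarrow> 0"
  proof (rule tendsto_0_le[OF D])
    have "norm ((B (X (Suc n)) - B z) \<bullet> (X (Suc n) - X n)) \<le> norm (X (Suc n) - X n) * (\<mu> * R)" for n
    proof -
      have "norm (B (X (Suc n)) - B z) \<le> \<mu> * R"
        using B_norm[of "X (Suc n)" z] mult_left_mono[OF R[of n], of \<mu>] pos by linarith
      then show ?thesis
        using Cauchy_Schwarz_ineq2[of "B (X (Suc n)) - B z" "X (Suc n) - X n"]
          mult_right_mono[of "norm (B (X (Suc n)) - B z)" "\<mu> * R" "norm (X (Suc n) - X n)"]
        by (simp add: mult.commute)
    qed
    then show "\<forall>\<^sub>F n in sequentially. norm ((B (X (Suc n)) - B z) \<bullet> (X (Suc n) - X n))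
        \<le> norm (X (Suc n) - X n) * (\<mu> * R)"
      by simp
  qed
  have "(\<lambda>n. (B (Y n) - B z) \<bullet> (X (Suc n) - X n)) \<longlonglongrightarrow> 0"
    using tendsto_add[OF BY BX] by (simp add: inner_diff_left)
  then have "(\<lambda>n. energy z n - (norm (X (Suc n) - X n))\<^sup>2 - 2 * \<gamma> * ((B (Y n) - B z) \<bullet> (X (Suc n) - X n))
      - \<gamma> * \<mu> * (1 + sqrt 2) * (norm (X (Suc n) - X n))\<^sup>2 - \<gamma> * \<mu> * (norm (X (Suc n) - Y n))\<^sup>2)
    \<longlonglongrightarrow> t - (norm (0::'a))\<^sup>2 - 2 * \<gamma> * 0 - \<gamma> * \<mu> * (1 + sqrt 2) * (norm (0::'a))\<^sup>2 - \<gamma> * \<mu> * (norm (0::'a))\<^sup>2"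
    by (intro tendsto_intros t D E)
  then show ?thesis
    unfolding convergent_def energy_def lyapunov_def by auto
qed

text \<open>The resolvent inclusion supplies \<open>?w n\<close> in \<open>A (X (Suc n))\<close>.
  Adding \<open>B\<close> and \<open>C\<close> at that point leaves only differences that vanish, so
  demiclosedness applies to \<open>A\<close> perturbed by the sum of \<open>B\<close> and
  \<open>C\<close>.\<close>

lemma weak_cluster_is_zero:
  assumes z: "- (B z + C z) \<in> A z"
    and F: "F \<noteq> bot" "F \<le> sequentially"
    and weak: "\<And>u. ((\<lambda>n. X (Suc n) \<bullet> u) \<longlongrightarrow> l \<bullet> u) F"
  shows "- (B l + C l) \<in> A l"
proof -
  let ?w = "\<lambda>n. (1 / \<gamma>) *\<^sub>R (X n - \<gamma> *\<^sub>R B (Y n) - \<gamma> *\<^sub>R C (X n) - X (Suc n))"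
  obtain R where R: "\<And>n. norm (X (Suc n) - z) \<le> R"
    using X_bounded[OF z] by metis
  have bounded: "norm (X (Suc n)) \<le> norm z + R" for n
    using norm_triangle_sub[of "X (Suc n)" z] R[of n] by linarith
  have C_lip: "(1 / \<beta>)-lipschitz_on UNIV C"
    using C pos(2) by (rule cocoercive_imp_lipschitz)
  note D = X_diff_tendsto_0[OF z] and E = X_Y_diff_tendsto_0[OF z]
  have eq: "?w n + (B (X (Suc n)) + C (X (Suc n)))
      = - (1 / \<gamma>) *\<^sub>R (X (Suc n) - X n) + (B (X (Suc n)) - B (Y n)) + (C (X (Suc n)) - C (X n))" for n
    using pos by (simp add: algebra_simps)
  have "(\<lambda>n. ?w n + (B (X (Suc n)) + C (X (Suc n)))) \<longlonglongrightarrow> - (1 / \<gamma>) *\<^sub>R 0 + 0 + 0"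
    unfolding eq
    by (intro tendsto_intros lipschitz_diff_tendsto_0[OF B_lip] lipschitz_diff_tendsto_0[OF C_lip] D E)
  from tendsto_mono[OF F(2) this]
  have null: "((\<lambda>n. ?w n + (B (X (Suc n)) + C (X (Suc n)))) \<longlongrightarrow> 0) F"
    by simp
  have "0 \<le> \<beta> * (norm (C x - C y))\<^sup>2" for x y
    using pos by simp
  then have "0 \<le> (x - y) \<bullet> (C x - C y)" for x y
    using C unfolding cocoercive_def by (meson order_trans)
  then have M_mono: "0 \<le> (x - y) \<bullet> (B x + C x - (B y + C y))" for x y
    using B_mono[of x y] by (simp add: add_diff_add inner_add_right)
  show ?thesis
    by (rule monotone_sum_demiclosed[OF A lipschitz_on_add[OF B_lip C_lip] M_mono F(1) bounded weak X null])
qed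

theorem weak_convergence:
  assumes z: "- (B z + C z) \<in> A z"
  shows "\<exists>l. - (B l + C l) \<in> A l \<and> converges_weakly X l"
proof -
  let ?Z = "{z. - (B z + C z) \<in> A z}"
  have "\<exists>l\<in>?Z. converges_weakly (\<lambda>n. X (Suc n)) l"
  proof (rule opial)
    show "z \<in> ?Z"
      using z by simp
    show "convergent (\<lambda>n. (norm (X (Suc n) - z'))\<^sup>2)" if "z' \<in> ?Z" for z'
      using that norm_diff_convergent by blast
    show "l \<in> ?Z" if "G \<noteq> bot" "G \<le> sequentially" "\<And>u. ((\<lambda>n. X (Suc n) \<bullet> u) \<longlongrightarrow> l \<bullet> u) G" for G l
      using weak_cluster_is_zero[OF z that] by simp
  qed
  then show ?thesis
    unfolding converges_weakly_def by (auto dest!: LIMSEQ_imp_Suc)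
qed

end

theorem theorem3p3:
  fixes A :: "'a::{real_inner, complete_space} \<Rightarrow> 'a set"
    and B C :: "'a \<Rightarrow> 'a"
    and \<mu> \<beta> \<zeta> \<xi> \<gamma> :: real
    and x :: "int \<Rightarrow> 'a"
    and y :: "nat \<Rightarrow> 'a"
  assumes "\<mu> > 0" and "\<beta> > 0"
    and "maximally_monotone A"
    and "monotone_op (single_op B)" and "\<mu>-lipschitz_on UNIV B"
    and "cocoercive \<beta> C"
    and "zer (sum_op (sum_op A (single_op B)) (single_op C)) \<noteq> {}"
    and "\<zeta> \<in> {0<..<1/2}" and "\<xi> \<in> {0<..}"
    and "\<gamma> > 0"
    and "\<gamma> < (1 - \<zeta>) / \<mu>"
    and "\<gamma> < 4 * \<beta> * \<zeta> / (1 + \<xi>)"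
    and "\<gamma> < (sqrt 2 - 1) / \<mu>"
    and "\<gamma> < (1 - 2 * \<zeta>) / (\<mu> * (sqrt 2 + 1) + 2 / (\<beta> * \<xi>))"
    and "\<And>n::nat. y n = 2 *\<^sub>R x (int n) - x (int n - 1)"
    and "\<And>n::nat. x (int n + 1) =
      resolvent (scale_op \<gamma> A) (x (int n) - \<gamma> *\<^sub>R B (y n) - \<gamma> *\<^sub>R C (x (int n)))"
  shows "\<exists>xbar \<in> zer (sum_op (sum_op A (single_op B)) (single_op C)).
    converges_weakly (\<lambda>n::nat. x (int n)) xbar"
proof -
  have \<zeta>: "0 < \<zeta>" "\<zeta> < 1/2" and "0 < \<xi>"
    using assms(8,9) by auto
  \<comment> \<open>The locale condition \<open>step\<close> is split at \<open>2 * \<zeta>\<close>: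
    the cocoercive part \<open>\<gamma> / (2 * \<beta>)\<close> stays below it, the Lipschitz part
    below \<open>1 - 2 * \<zeta>\<close>.\<close>
  have "\<gamma> < 4 * \<beta> * \<zeta>"
  proof (rule less_le_trans[OF assms(12)])
    show "4 * \<beta> * \<zeta> / (1 + \<xi>) \<le> 4 * \<beta> * \<zeta>"
      using \<open>\<beta> > 0\<close> \<zeta> \<open>0 < \<xi>\<close> by (simp add: field_simps)
  qed
  then have "\<gamma> / (2 * \<beta>) < 2 * \<zeta>"
    using \<open>\<beta> > 0\<close> by (simp add: field_simps)
  moreover have "\<gamma> * \<mu> * (1 + sqrt 2) < 1 - 2 * \<zeta>"
  proof -
    \<comment> \<open>Dropping the positive summand \<open>2 / (\<beta> * \<xi>)\<close> of the
      denominator leaves the bound on the Lipschitz part.\<close>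
    let ?D = "\<mu> * (sqrt 2 + 1) + 2 / (\<beta> * \<xi>)"
    have "\<mu> * (sqrt 2 + 1) \<ge> 0" and p: "2 / (\<beta> * \<xi>) > 0"
      using \<open>\<mu> > 0\<close> \<open>\<beta> > 0\<close> \<open>0 < \<xi>\<close> by auto
    then have "\<gamma> * ?D < 1 - 2 * \<zeta>"
      using assms(14) by (subst pos_less_divide_eq[symmetric]) linarith+
    moreover have "\<gamma> * (2 / (\<beta> * \<xi>)) > 0"
      using p \<open>\<gamma> > 0\<close> by (rule mult_pos_pos[rotated])
    ultimately show ?thesis
      by (simp add: algebra_simps)
  qed
  ultimately have step: "\<gamma> / (2 * \<beta>) + \<gamma> * \<mu> * (1 + sqrt 2) < 1"
    by linarith
  interpret reflected_forward_backward A B C \<mu> \<beta> \<gamma> "\<lambda>n. x (int n)" y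
  proof
    show "0 \<le> (p - q) \<bullet> (B p - B q)" for p q
      using monotone_opD[OF assms(4), of "B p" p "B q" q] by (simp add: single_op_def)
    show "y (Suc n) = 2 *\<^sub>R x (int (Suc n)) - x (int n)" for n
      using assms(15)[of "Suc n"] by simp
    show "(1 / \<gamma>) *\<^sub>R (x (int n) - \<gamma> *\<^sub>R B (y n) - \<gamma> *\<^sub>R C (x (int n)) - x (int (Suc n)))
        \<in> A (x (int (Suc n)))" for n
      using resolvent_scale_op[OF assms(3) \<open>\<gamma> > 0\<close>] assms(16)[of n] by (simp add: add.commute)
  qed (use assms step in auto)
  obtain z where "- (B z + C z) \<in> A z"
    using assms(7) by (auto simp: mem_zer_sum_iff)
  from weak_convergence[OF this] show ?thesis
    by (auto simp: mem_zer_sum_iff)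
qed

end
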